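(* Let $p:[\omega_1]^2\to\omega$ be a partition and $X\subseteq\omega_1$ uncountable such that $p\restriction[X]^2$ does not witness $\mathrm{U}(\omega_1,\omega_1,\omega,\omega)$. Then for every coloring $c:[\omega_1]^2\to\omega$ with finite-to-one fibers there exists $j<\omega$ such that $\{c(\alpha,\beta)\mid(\alpha,\beta)\in[X]^2,\ p(\alpha,\beta)=j\}$ is infinite.
   Context: $[A]^2$ denotes pairs $(\alpha,\beta)$ from $A$ with $\alpha<\beta$; for sets of ordinals $a<b$ means every element of $a$ is below every element of $b$, and for a family $\mathcal B$, $[\mathcal B]^2=\{(a,b)\in\mathcal B^2\mid a<b\}$. $p\restriction[X]^2$ witnesses $\mathrm{U}(\omega_1,\omega_1,\omega,\omega)$ iff for every $\sigma<\omega$, every uncountable family $\mathcal A$ of pairwise disjoint subsets of $X$ each of size $\sigma$, and every $\delta<\omega$, there is an uncountable $\mathcal B\subseteq\mathcal A$ with $\min(p[a\times b])>\delta$ for all $(a,b)\in[\mathcal B]^2$. A coloring $c:[\omega_1]^2\to\omega$ has finite-to-one fibers iff for all $\beta<\omega_1$ and $j<\omega$, $\{\alpha<\beta\mid c(\alpha,\beta)=j\}$ is finite. *)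

theory Defs
  imports "HOL-Library.Countable_Set_Type" "HOL-Library.Disjoint_Sets"
begin

text \<open>The type \<open>omega1\<close> is the first uncountable ordinal: its elements are those of the
  well-order \<open>cardSuc natLeq\<close>, the successor cardinal of \<open>\<omega>\<close>, ordered by that relation.\<close>

typedef omega1 = "Field (cardSuc natLeq)"
proof -
  have "Field (cardSuc natLeq) \<noteq> {}"
    using cardSuc_greater[OF natLeq_Card_order] natLeq_Card_order
    by (metis Field_natLeq UNIV_not_empty cardSuc_greater cardSuc_finite infinite_UNIV_nat finite.emptyI)
  then show ?thesis by blast
qed

lemma wo_cardSuc_natLeq: "Well_order (cardSuc natLeq)"
  using cardSuc_Card_order[OF natLeq_Card_order] by (simp add: card_order_on_def)

instantiation omega1 :: wellorder
begin

definition less_eq_omega1 :: "omega1 \<Rightarrow> omega1 \<Rightarrow> bool" where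
  "x \<le> y \<longleftrightarrow> (Rep_omega1 x, Rep_omega1 y) \<in> cardSuc natLeq"

definition less_omega1 :: "omega1 \<Rightarrow> omega1 \<Rightarrow> bool" where
  "x < y \<longleftrightarrow> x \<le> y \<and> x \<noteq> (y :: omega1)"

instance
proof
  interpret wo_rel "cardSuc natLeq"
    by (simp add: wo_rel_def wo_cardSuc_natLeq)
  fix x y z :: omega1
  show refl: "x \<le> x"
    using REFL Rep_omega1[of x] by (auto simp: less_eq_omega1_def refl_on_def)
  show antisym: "x \<le> y \<Longrightarrow> y \<le> x \<Longrightarrow> x = y"
    using ANTISYM unfolding less_eq_omega1_def antisym_def by (metis Rep_omega1_inject)
  then show "x < y \<longleftrightarrow> x \<le> y \<and> \<not> y \<le> x"
    using refl by (auto simp: less_omega1_def)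
  show "x \<le> y \<Longrightarrow> y \<le> z \<Longrightarrow> x \<le> z"
    using TRANS unfolding less_eq_omega1_def trans_def by blast
  show "x \<le> y \<or> y \<le> x"
    using TOTALS Rep_omega1 unfolding less_eq_omega1_def by blast
next
  fix P :: "omega1 \<Rightarrow> bool" and a :: omega1
  assume step: "\<And>x. (\<And>y. y < x \<Longrightarrow> P y) \<Longrightarrow> P x"
  have "wf (inv_image (cardSuc natLeq - Id) Rep_omega1)"
    using wo_cardSuc_natLeq by (simp add: well_order_on_def wf_inv_image)
  then show "P a"
  proof (induction a rule: wf_induct_rule)
    case (less x)
    show ?case
      by (rule step, rule less)
        (auto simp: less_omega1_def less_eq_omega1_def Rep_omega1_inject)
  qed
qed

end

lemma range_Rep_omega1: "range Rep_omega1 = Field (cardSuc natLeq)"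
  using type_definition.Rep_range[OF type_definition_omega1] .

lemma uncountable_UNIV_omega1:
  includes cardinal_syntax
  shows "uncountable (UNIV :: omega1 set)"
proof
  assume "countable (UNIV :: omega1 set)"
  then have "countable (Field (cardSuc natLeq))"
    by (metis countable_image range_Rep_omega1)
  then have "|Field (cardSuc natLeq)| \<le>o natLeq"
    by (simp add: countable_card_le_natLeq)
  then have "cardSuc natLeq \<le>o natLeq"
    using card_of_Field_ordIso[OF cardSuc_Card_order[OF natLeq_Card_order]]
    by (metis ordIso_ordLeq_trans ordIso_symmetric)
  then show False
    using cardSuc_greater[OF natLeq_Card_order] not_ordLess_ordLeq by blast
qed

lemma countable_lessThan_omega1:
  includes cardinal_syntax
  shows "countable {..<x :: omega1}"
proof -
  let ?r = "cardSuc natLeq"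
  have "|underS ?r (Rep_omega1 x)| <o ?r"
    using card_of_underS[OF cardSuc_Card_order[OF natLeq_Card_order] Rep_omega1] .
  then have "|underS ?r (Rep_omega1 x)| \<le>o natLeq"
    using cardSuc_ordLeq_ordLess[OF natLeq_Card_order card_of_Card_order] by blast
  then have "countable (underS ?r (Rep_omega1 x))"
    by (simp add: countable_card_le_natLeq)
  moreover have "Rep_omega1 ` {..<x} \<subseteq> underS ?r (Rep_omega1 x)"
    by (auto simp: underS_def less_omega1_def less_eq_omega1_def Rep_omega1_inject)
  ultimately have "countable (Rep_omega1 ` {..<x})"
    using countable_subset by blast
  then show ?thesis
    by (meson Rep_omega1_inject countable_image_inj_on inj_onI)
qed

definition pairs :: "'a::linorder set \<Rightarrow> ('a \<times> 'a) set" where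
  "pairs A = {(\<alpha>, \<beta>). \<alpha> \<in> A \<and> \<beta> \<in> A \<and> \<alpha> < \<beta>}"

definition set_less :: "'a::linorder set \<Rightarrow> 'a set \<Rightarrow> bool" where
  "set_less a b \<longleftrightarrow> (\<forall>\<alpha>\<in>a. \<forall>\<beta>\<in>b. \<alpha> < \<beta>)"

definition set_pairs :: "'a::linorder set set \<Rightarrow> ('a set \<times> 'a set) set" where
  "set_pairs \<B> = {(a, b). a \<in> \<B> \<and> b \<in> \<B> \<and> set_less a b}"

text \<open>A colouring of increasing pairs of countable ordinals is a total function on
  \<open>omega1 \<times> omega1\<close>; its values off \<open>pairs UNIV\<close> are never used.
  \<open>witnesses_U p X\<close> says that \<open>p\<close> restricted to \<open>pairs X\<close> witnesses
  \<open>U(\<omega>\<^sub>1, \<omega>\<^sub>1, \<omega>, \<omega>)\<close>. The minimum is always over a nonempty finite set,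
  since for \<open>\<sigma> = 0\<close> no family \<open>\<A>\<close> is uncountable.\<close>

definition witnesses_U :: "(omega1 \<times> omega1 \<Rightarrow> nat) \<Rightarrow> omega1 set \<Rightarrow> bool" where
  "witnesses_U p X \<longleftrightarrow>
    (\<forall>\<sigma>::nat. \<forall>\<A>::omega1 set set. \<forall>\<delta>::nat.
      uncountable \<A> \<and> disjoint \<A> \<and> (\<forall>a\<in>\<A>. a \<subseteq> X \<and> finite a \<and> card a = \<sigma>) \<longrightarrow>
      (\<exists>\<B>\<subseteq>\<A>. uncountable \<B> \<and> (\<forall>(a, b)\<in>set_pairs \<B>. Min (p ` (a \<times> b)) > \<delta>)))"

definition finite_to_one_fibers :: "(omega1 \<times> omega1 \<Rightarrow> nat) \<Rightarrow> bool" where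
  "finite_to_one_fibers c \<longleftrightarrow> (\<forall>\<beta> j. finite {\<alpha>. \<alpha> < \<beta> \<and> c (\<alpha>, \<beta>) = j})"

end

theory Submission
  imports Defs
begin

text \<open>If every set of colours \<open>c(\<alpha>, \<beta>)\<close> with \<open>p(\<alpha>, \<beta>) = j\<close> were finite, then \<open>p\<close> would inherit
  finite-to-one fibers on \<open>X\<close> from \<open>c\<close>. Given a disjoint family \<open>\<A>\<close> of finite sets and a bound
  \<open>\<delta>\<close>, join \<open>a < b\<close> by an edge when \<open>min(p[a \<times> b]) \<le> \<delta>\<close>. Every vertex then has only finitely
  many smaller neighbours, so a greedy colouring uses countably many colours, and some colour class
  is an uncountable independent set.\<close>

lemma wf_finite_preds_nat_coloring:
  assumes "wf R" and fin: "\<And>y. finite {x. (x, y) \<in> R}"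
  obtains f :: "'a \<Rightarrow> nat" where "\<And>x y. (x, y) \<in> R \<Longrightarrow> f x \<noteq> f y"
proof -
  define F where "F = (\<lambda>(f :: 'a \<Rightarrow> nat) y. LEAST n. n \<notin> f ` {x. (x, y) \<in> R})"
  define f where "f = wfrec R F"
  have f_eq: "f y = (LEAST n. n \<notin> f ` {x. (x, y) \<in> R})" for y
  proof -
    have "f y = F (cut f R y) y"
      unfolding f_def by (rule wfrec[OF \<open>wf R\<close>])
    \<comment> \<open>The recursion consults \<open>f\<close> only at predecessors of
      \<open>y\<close>, where \<open>cut f R y\<close> agrees with \<open>f\<close>.\<close>
    also have "cut f R y ` {x. (x, y) \<in> R} = f ` {x. (x, y) \<in> R}"
      by (auto simp: cut_apply image_iff)
    then have "F (cut f R y) y = (LEAST n. n \<notin> f ` {x. (x, y) \<in> R})"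
      by (simp add: F_def)
    finally show ?thesis .
  qed
  have "f y \<notin> f ` {x. (x, y) \<in> R}" for y
  proof -
    have "\<exists>n. n \<notin> f ` {x. (x, y) \<in> R}"
      using ex_new_if_finite[OF infinite_UNIV_nat finite_imageI[OF fin]] .
    then show ?thesis
      unfolding f_eq[of y] by (rule LeastI_ex)
  qed
  then have "f x \<noteq> f y" if "(x, y) \<in> R" for x y
    using that by (metis imageI mem_Collect_eq)
  then show thesis
    by (rule that)
qed

lemma uncountable_nat_fiber:
  fixes f :: "'a \<Rightarrow> nat"
  assumes "uncountable A"
  obtains n where "uncountable {x \<in> A. f x = n}"
proof (rule ccontr)
  assume "\<not> thesis"
  then have "countable (\<Union>n. {x \<in> A. f x = n})"
    using that by (intro countable_UN) auto
  then have "countable A"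
    by (rule countable_subset[rotated]) auto
  then show False
    using assms by blast
qed

lemma finite_fibers_witnesses_U:
  assumes fin: "\<And>\<beta> \<delta>. \<beta> \<in> X \<Longrightarrow> finite {\<alpha> \<in> X. \<alpha> < \<beta> \<and> p (\<alpha>, \<beta>) \<le> \<delta>}"
  shows "witnesses_U p X"
  unfolding witnesses_U_def
proof (intro allI impI, elim conjE)
  fix \<sigma> :: nat and \<A> :: "omega1 set set" and \<delta> :: nat
  assume unc: "uncountable \<A>" and disj: "disjoint \<A>"
    and \<A>: "\<forall>a\<in>\<A>. a \<subseteq> X \<and> finite a \<and> card a = \<sigma>"
  have "\<sigma> \<noteq> 0"
  proof
    assume "\<sigma> = 0"
    then have "\<A> \<subseteq> {{}}"
      using \<A> by auto
    then show False
      using unc countable_subset[of \<A> "{{}}"] by simp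
  qed
  then have ne: "a \<noteq> {}" if "a \<in> \<A>" for a
    using \<A> that by auto
  define R where "R = {(a, b) \<in> set_pairs \<A>. Min (p ` (a \<times> b)) \<le> \<delta>}"
  \<comment> \<open>\<open>Min\<close> maps \<open>R\<close> into the strict well-order of
    \<open>omega1\<close>, which makes \<open>R\<close> well-founded.\<close>
  have "Min a < Min b" if "(a, b) \<in> R" for a b
    using that \<A> ne by (auto simp: R_def set_pairs_def set_less_def)
  then have "R \<subseteq> inv_image {(x, y). x < y} Min"
    by auto
  then have "wf R"
    by (rule wf_subset[OF wf_inv_image[OF wf]])
  moreover have "finite {a. (a, b) \<in> R}" for b
  proof (cases "b \<in> \<A>")
    case True
    \<comment> \<open>Every \<open>R\<close>-predecessor of \<open>b\<close> meets the finite set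
      \<open>F\<close>, and by disjointness each point of \<open>F\<close> lies in at most one
      member of \<open>\<A>\<close>.\<close>
    define F where "F = (\<Union>\<beta>\<in>b. {\<alpha> \<in> X. \<alpha> < \<beta> \<and> p (\<alpha>, \<beta>) \<le> \<delta>})"
    have "finite F"
      using True \<A> fin unfolding F_def by blast
    moreover have "finite {a \<in> \<A>. \<alpha> \<in> a}" for \<alpha>
    proof -
      have "a = a'" if "a \<in> \<A>" "a' \<in> \<A>" "\<alpha> \<in> a" "\<alpha> \<in> a'" for a a'
        using disjointD[OF disj] that by blast
      then have "{a \<in> \<A>. \<alpha> \<in> a} = {} \<or> (\<exists>a. {a \<in> \<A>. \<alpha> \<in> a} = {a})"
        by blast
      then show ?thesis
        by (metis finite.emptyI finite.insertI)
    qed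
    moreover have "{a. (a, b) \<in> R} \<subseteq> (\<Union>\<alpha>\<in>F. {a \<in> \<A>. \<alpha> \<in> a})"
    proof
      fix a assume "a \<in> {a. (a, b) \<in> R}"
      then have a: "a \<in> \<A>" "set_less a b" and le: "Min (p ` (a \<times> b)) \<le> \<delta>"
        by (auto simp: R_def set_pairs_def)
      have "Min (p ` (a \<times> b)) \<in> p ` (a \<times> b)"
        using a True \<A> ne by (intro Min_in) auto
      then obtain \<alpha> \<beta> where "\<alpha> \<in> a" "\<beta> \<in> b" "p (\<alpha>, \<beta>) \<le> \<delta>"
        using le by auto
      then show "a \<in> (\<Union>\<alpha>\<in>F. {a \<in> \<A>. \<alpha> \<in> a})"
        using a \<A> unfolding F_def set_less_def by blast
    qed
    ultimately show ?thesis
      using finite_subset by blast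
  next
    case False
    then show ?thesis
      by (simp add: R_def set_pairs_def)
  qed
  ultimately obtain f :: "omega1 set \<Rightarrow> nat" where f: "\<And>a b. (a, b) \<in> R \<Longrightarrow> f a \<noteq> f b"
    using wf_finite_preds_nat_coloring by blast
  obtain n where n: "uncountable {a \<in> \<A>. f a = n}"
    using uncountable_nat_fiber[OF unc] .
  \<comment> \<open>A pair a < b violating the bound would be in \<open>R\<close>, so
    \<open>f\<close> would separate it.\<close>
  have "\<forall>(a, b)\<in>set_pairs {a \<in> \<A>. f a = n}. Min (p ` (a \<times> b)) > \<delta>"
    using f by (fastforce simp: R_def set_pairs_def not_le[symmetric])
  then show "\<exists>\<B>\<subseteq>\<A>. uncountable \<B> \<and> (\<forall>(a, b)\<in>set_pairs \<B>. Min (p ` (a \<times> b)) > \<delta>)"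
    using n by (intro exI[of _ "{a \<in> \<A>. f a = n}"]) auto
qed

theorem theorem3p9:
  fixes p :: "omega1 \<times> omega1 \<Rightarrow> nat" and X :: "omega1 set"
  assumes "uncountable X"
    and "\<not> witnesses_U p X"
  shows "\<forall>c :: omega1 \<times> omega1 \<Rightarrow> nat. finite_to_one_fibers c \<longrightarrow>
    (\<exists>j. infinite {c (\<alpha>, \<beta>) | \<alpha> \<beta>. (\<alpha>, \<beta>) \<in> pairs X \<and> p (\<alpha>, \<beta>) = j})"
proof (intro allI impI, rule ccontr)
  fix c :: "omega1 \<times> omega1 \<Rightarrow> nat"
  define S where "S j = {c (\<alpha>, \<beta>) | \<alpha> \<beta>. (\<alpha>, \<beta>) \<in> pairs X \<and> p (\<alpha>, \<beta>) = j}" for j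
  assume c: "finite_to_one_fibers c"
    and "\<nexists>j. infinite {c (\<alpha>, \<beta>) | \<alpha> \<beta>. (\<alpha>, \<beta>) \<in> pairs X \<and> p (\<alpha>, \<beta>) = j}"
  then have S: "finite (S j)" for j
    unfolding S_def by blast
  have "finite {\<alpha> \<in> X. \<alpha> < \<beta> \<and> p (\<alpha>, \<beta>) \<le> \<delta>}" if "\<beta> \<in> X" for \<beta> \<delta>
  proof (rule finite_subset)
    \<comment> \<open>With j = p(\<alpha>, \<beta>) \<le> \<delta>, the colour c(\<alpha>, \<beta>)
      lies in \<open>S j\<close>; so only finitely many colours occur, each with a finite fiber
      below \<beta>.\<close>
    show "{\<alpha> \<in> X. \<alpha> < \<beta> \<and> p (\<alpha>, \<beta>) \<le> \<delta>} \<subseteq>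
        (\<Union>t\<in>\<Union>j\<le>\<delta>. S j. {\<alpha>. \<alpha> < \<beta> \<and> c (\<alpha>, \<beta>) = t})"
      using that by (auto simp: S_def pairs_def)
    show "finite (\<Union>t\<in>\<Union>j\<le>\<delta>. S j. {\<alpha>. \<alpha> < \<beta> \<and> c (\<alpha>, \<beta>) = t})"
      using S c unfolding finite_to_one_fibers_def by blast
  qed
  then show False
    using finite_fibers_witnesses_U assms(2) by blast
qed

end
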